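(* Let $V:\mathbb R^n\times\mathbb R^l\to\mathbb R$ be a reference-dependent Lyapunov function for the prestabilized system $\dot{\bm x}=f_\pi(\bm x,\bm v)$ such that, for every $\bm v\in\mathbb R^l$ and every $\bm x\in\mathcal D_{\bm v}\setminus\{\bar x(\bm v)\}$, $\frac{\partial V}{\partial\bm x}(\bm x,\bm v)\ne 0$. If the safety threshold value $\Gamma^*:\mathbb R^l\to\mathbb R$ and the stability threshold value $\overline\Gamma:\mathbb R^l\to\mathbb R$ are (real-valued and) continuously differentiable, and $\mathcal X\subset\mathbb R^n$ and $\mathcal V\subset\mathbb R^l$ are compact, then for any $\epsilon\in(0,1)$ the function $\Delta:\tilde{\mathcal D}\to\mathbb R^2$, $$\Delta(\bm x,\bm v)=\begin{bmatrix}\Gamma^*(\bm v)-V(\bm x,\bm v)\\ (1-\epsilon)\overline\Gamma(\bm v)-V(\bm x,\bm v)\end{bmatrix},$$ is a dynamic safety margin (DSM).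
   Context: Class $\mathscr K$: continuous strictly increasing $\alpha:[0,\infty)\to[0,\infty)$ with $\alpha(0)=0$. System: $\dot{\bm x}=f(\bm x)+g(\bm x)\bm u$, with $f:\mathbb R^n\to\mathbb R^n$ and $g:\mathbb R^n\to\mathbb R^{n\times m}$ locally Lipschitz, subject to $\bm x\in\mathcal X$, $\bm u\in\mathcal U$, where $\mathcal X\subset\mathbb R^n$ and $\mathcal U\subset\mathbb R^m$ are closed. Equilibria: there is a simply connected manifold of stabilizable equilibria parameterized by continuous $\bar x:\mathbb R^l\to\mathbb R^n$, $\bar u:\mathbb R^l\to\mathbb R^m$ with $f(\bar x(\bm v))+g(\bar x(\bm v))\bar u(\bm v)=0$ for all $\bm v\in\mathbb R^l$. The set of steady-state admissible references $\mathcal V=\{\bm v\in\mathbb R^l\mid \bar x(\bm v)\in\mathcal X,\ \bar u(\bm v)\in\mathcal U\}$ is assumed nonempty. Prestabilizing controller: $\pi:\mathbb R^n\times\mathbb R^l\to\mathbb R^m$ is jointly continuous and locally Lipschitz in its first argument, $\pi(\bar x(\bm v),\bm v)=\bar u(\bm v)$, and for each fixed $\bm v$ the point $\bar x(\bm v)$ is an asymptotically stable equilibrium of $\dot{\bm x}=f_\pi(\bm x,\bm v):=f(\bm x)+g(\bm x)\pi(\bm x,\bm v)$. For each $\bm v$, $\mathcal D_{\bm v}\subset\mathbb R^n$ is an open set containing $\bar x(\bm v)$ such that solutions of $\dot{\bm x}=f_\pi(\bm x,\bm v)$ starting in $\mathcal D_{\bm v}$ converge to $\bar x(\bm v)$.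 The set $\tilde{\mathcal D}=\{(\bm x,\bm v)\in\mathbb R^n\times\mathbb R^l\mid \bm x\in\mathcal D_{\bm v}\}$ is assumed open in $\mathbb R^n\times\mathbb R^l$. Constraint sets: $\mathcal X_{\bm v}=\{\bm x\in\mathcal X\mid \pi(\bm x,\bm v)\in\mathcal U\}$, $\mathcal X^c_{\bm v}=\mathbb R^n\setminus\mathcal X_{\bm v}$, and $\tilde{\mathcal X}=\{(\bm x,\bm v)\in\mathbb R^n\times\mathbb R^l\mid \bm x\in\mathcal X_{\bm v},\ \bm v\in\mathcal V\}$. DSM: a continuously differentiable $\Delta:\tilde{\mathcal D}\to\mathbb R^{n_c}$ with components $\Delta_i$ is a dynamic safety margin if, with $\tilde{\mathcal C}=\{(\bm x,\bm v)\in\tilde{\mathcal D}\mid \Delta(\bm x,\bm v)\ge 0\}$ (componentwise inequality): (i) $\tilde{\mathcal C}\subset\tilde{\mathcal X}$; (ii) $\tilde{\mathcal C}$ is compact in $\mathbb R^n\times\mathbb R^l$; (iii) for every $i\in\{1,\dots,n_c\}$ and $(\bm x,\bm v)\in\tilde{\mathcal D}$, $\Delta_i(\bm x,\bm v)=0$ implies $\frac{\partial\Delta_i}{\partial\bm x}(\bm x,\bm v)f_\pi(\bm x,\bm v)\ge 0$. Reference-dependent Lyapunov function: a continuously differentiable $V:\mathbb R^n\times\mathbb R^l\to\mathbb R$ for which there exist $\gamma_1,\gamma_2\in\mathscr K$ such that for every $\bm v\in\mathbb R^l$ and every $\bm x\in\mathcal D_{\bm v}$ (the open set containing $\bar x(\bm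 v)$ from which solutions of $\dot{\bm x}=f_\pi(\bm x,\bm v)$ converge to $\bar x(\bm v)$), $\gamma_1(\|\bm x-\bar x(\bm v)\|)\le V(\bm x,\bm v)\le\gamma_2(\|\bm x-\bar x(\bm v)\|)$ and $\frac{\partial V}{\partial\bm x}(\bm x,\bm v)f_\pi(\bm x,\bm v)\le 0$. Threshold values: $\Gamma^*(\bm v)=\inf_{\bm x\in\mathcal X^c_{\bm v}\cap\mathcal D_{\bm v}}V(\bm x,\bm v)-\inf_{\bm x\in\mathcal X_{\bm v}\cap\mathcal D_{\bm v}}V(\bm x,\bm v)$ (safety) and $\overline\Gamma(\bm v)=\inf_{\bm x\in\partial\mathcal D_{\bm v}}V(\bm x,\bm v)$ (stability). *)

theory Defs
  imports "HOL-Analysis.Analysis"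
begin

definition class_K :: "(real \<Rightarrow> real) \<Rightarrow> bool" where
  "class_K \<alpha> \<longleftrightarrow> continuous_on {0..} \<alpha> \<and> strict_mono_on {0..} \<alpha> \<and> \<alpha> 0 = 0"

definition locally_Lipschitz :: "('a::metric_space \<Rightarrow> 'b::metric_space) \<Rightarrow> bool" where
  "locally_Lipschitz F \<longleftrightarrow> (\<forall>x. \<exists>r>0. \<exists>L. L-lipschitz_on (cball x r) F)"

definition C1_on ::
  "'a::real_normed_vector set \<Rightarrow> ('a \<Rightarrow> 'b::real_normed_vector) \<Rightarrow> bool" where
  "C1_on S F \<longleftrightarrow> (\<exists>F' :: 'a \<Rightarrow> ('a \<Rightarrow>\<^sub>L 'b).
      (\<forall>x\<in>S. (F has_derivative blinfun_apply (F' x)) (at x)) \<and> continuous_on S F')"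

text \<open>Topological manifolds (without boundary) inside a Euclidean space. The role of the model
  space of dimension \<open>d\<close> is played by a \<open>d\<close>-dimensional linear subspace of the ambient space;
  by invariance of domain this does not restrict \<open>d\<close>.\<close>

definition embedded_manifold :: "'a::euclidean_space set \<Rightarrow> bool" where
  "embedded_manifold M \<longleftrightarrow> (\<exists>d. \<forall>p\<in>M. \<exists>W (L :: 'a set) B.
      p \<in> W \<and> openin (top_of_set M) W \<and> subspace L \<and> dim L = d \<and>
      openin (top_of_set L) B \<and> W homeomorphic B)"

definition solution_from ::
  "('a::real_normed_vector \<Rightarrow> 'a) \<Rightarrow> 'a \<Rightarrow> (real \<Rightarrow> 'a) \<Rightarrow> bool" where
  "solution_from F x0 \<phi> \<longleftrightarrow>
     \<phi> 0 = x0 \<and> (\<forall>t\<ge>0. (\<phi> has_vector_derivative F (\<phi> t)) (at t within {0..}))"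

text \<open>Solutions from \<open>S\<close> exist for all forward time and tend to \<open>p\<close>.\<close>

definition solutions_converge ::
  "('a::real_normed_vector \<Rightarrow> 'a) \<Rightarrow> 'a set \<Rightarrow> 'a \<Rightarrow> bool" where
  "solutions_converge F S p \<longleftrightarrow> (\<forall>x0\<in>S.
     (\<exists>\<phi>. solution_from F x0 \<phi>) \<and> (\<forall>\<phi>. solution_from F x0 \<phi> \<longrightarrow> (\<phi> \<longlongrightarrow> p) at_top))"

definition asymptotically_stable :: "('a::real_normed_vector \<Rightarrow> 'a) \<Rightarrow> 'a \<Rightarrow> bool" where
  "asymptotically_stable F p \<longleftrightarrow> F p = 0 \<and>
     (\<forall>e>0. \<exists>d>0. \<forall>x0\<in>ball p d.
        (\<exists>\<phi>. solution_from F x0 \<phi>) \<and>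
        (\<forall>\<phi>. solution_from F x0 \<phi> \<longrightarrow> (\<forall>t\<ge>0. \<phi> t \<in> ball p e))) \<and>
     (\<exists>d>0. solutions_converge F (ball p d) p)"

text \<open>The data of the constrained, prestabilized system; functions of state and reference take
  pairs \<open>(x, v)\<close>.\<close>

locale prestabilized_data =
  fixes f :: "real^'n \<Rightarrow> real^'n"
    and g :: "real^'n \<Rightarrow> real^'m^'n"
    and X :: "(real^'n) set"
    and U :: "(real^'m) set"
    and xbar :: "real^'l \<Rightarrow> real^'n"
    and ubar :: "real^'l \<Rightarrow> real^'m"
    and \<pi> :: "(real^'n) \<times> (real^'l) \<Rightarrow> real^'m"
    and D :: "real^'l \<Rightarrow> (real^'n) set"
begin

definition f_cl :: "(real^'n) \<times> (real^'l) \<Rightarrow> real^'n" where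
  "f_cl = (\<lambda>(x, v). f x + g x *v \<pi> (x, v))"

definition admissible_refs :: "(real^'l) set" where
  "admissible_refs = {v. xbar v \<in> X \<and> ubar v \<in> U}"

definition D_tilde :: "((real^'n) \<times> (real^'l)) set" where
  "D_tilde = {(x, v). x \<in> D v}"

definition X_ref :: "real^'l \<Rightarrow> (real^'n) set" where
  "X_ref v = {x \<in> X. \<pi> (x, v) \<in> U}"

definition X_tilde :: "((real^'n) \<times> (real^'l)) set" where
  "X_tilde = {(x, v). x \<in> X_ref v \<and> v \<in> admissible_refs}"

definition C_tilde ::
  "((real^'n) \<times> (real^'l) \<Rightarrow> real^'c) \<Rightarrow> ((real^'n) \<times> (real^'l)) set" where
  "C_tilde \<Delta> = {p \<in> D_tilde. \<forall>i. \<Delta> p $ i \<ge> 0}"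

definition dynamic_safety_margin :: "((real^'n) \<times> (real^'l) \<Rightarrow> real^'c) \<Rightarrow> bool" where
  "dynamic_safety_margin \<Delta> \<longleftrightarrow>
     C1_on D_tilde \<Delta> \<and>
     C_tilde \<Delta> \<subseteq> X_tilde \<and>
     compact (C_tilde \<Delta>) \<and>
     (\<forall>i x v. (x, v) \<in> D_tilde \<longrightarrow> \<Delta> (x, v) $ i = 0 \<longrightarrow>
        frechet_derivative (\<lambda>y. \<Delta> (y, v) $ i) (at x) (f_cl (x, v)) \<ge> 0)"

definition ref_Lyapunov :: "((real^'n) \<times> (real^'l) \<Rightarrow> real) \<Rightarrow> bool" where
  "ref_Lyapunov V \<longleftrightarrow>
     C1_on UNIV V \<and>
     (\<exists>\<gamma>1 \<gamma>2. class_K \<gamma>1 \<and> class_K \<gamma>2 \<and>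
        (\<forall>v. \<forall>x\<in>D v.
           \<gamma>1 (norm (x - xbar v)) \<le> V (x, v) \<and> V (x, v) \<le> \<gamma>2 (norm (x - xbar v)) \<and>
           frechet_derivative (\<lambda>y. V (y, v)) (at x) (f_cl (x, v)) \<le> 0))"

text \<open>The thresholds are extended reals, so that an infimum over the empty set is \<open>\<infinity>\<close> and being
  real-valued is a genuine hypothesis. For a Lyapunov function both infima below are
  nonnegative and at most one of them is \<open>\<infinity>\<close>, so the difference is never \<open>\<infinity> - \<infinity>\<close>.\<close>

definition safety_threshold ::
  "((real^'n) \<times> (real^'l) \<Rightarrow> real) \<Rightarrow> real^'l \<Rightarrow> ereal" where
  "safety_threshold V v =
     (INF x \<in> (- X_ref v) \<inter> D v. ereal (V (x, v))) - (INF x \<in> X_ref v \<inter> D v. ereal (V (x, v)))"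

definition stability_threshold ::
  "((real^'n) \<times> (real^'l) \<Rightarrow> real) \<Rightarrow> real^'l \<Rightarrow> ereal" where
  "stability_threshold V v = (INF x \<in> frontier (D v). ereal (V (x, v)))"

end

text \<open>Stabilizability of the equilibria \<open>(xbar v, ubar v)\<close> by feedback is witnessed by \<open>\<pi>\<close>, hence
  not listed separately.\<close>

locale prestabilized_system = prestabilized_data +
  assumes f_lipschitz: "locally_Lipschitz f"
    and g_lipschitz: "locally_Lipschitz g"
    and X_closed: "closed X"
    and U_closed: "closed U"
    and xbar_continuous: "continuous_on UNIV xbar"
    and ubar_continuous: "continuous_on UNIV ubar"
    and equilibria: "\<And>v. f (xbar v) + g (xbar v) *v ubar v = 0"
    and equilibria_simply_connected: "simply_connected (range (\<lambda>v. (xbar v, ubar v)))"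
    and equilibria_manifold: "embedded_manifold (range (\<lambda>v. (xbar v, ubar v)))"
    and admissible_refs_nonempty: "admissible_refs \<noteq> {}"
    and pi_continuous: "continuous_on UNIV \<pi>"
    and pi_lipschitz: "\<And>v. locally_Lipschitz (\<lambda>x. \<pi> (x, v))"
    and pi_equilibrium: "\<And>v. \<pi> (xbar v, v) = ubar v"
    and prestabilizing: "\<And>v. asymptotically_stable (\<lambda>x. f_cl (x, v)) (xbar v)"
    and D_open: "\<And>v. open (D v)"
    and xbar_in_D: "\<And>v. xbar v \<in> D v"
    and D_attraction: "\<And>v. solutions_converge (\<lambda>x. f_cl (x, v)) (D v) (xbar v)"
    and D_tilde_open: "open D_tilde"

end

theory Submission
  imports Defs
begin

text \<open>The subtle point is that \<open>C_tilde\<close> is closed, since \<open>D v\<close> may shrink abruptly at a limit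
  reference \<open>v\<close>, so that a limit state need not even lie in the closure of \<open>D v\<close>. On the frontier of
  \<open>D v\<close>, \<open>V\<close> exceeds \<open>(1 - \<epsilon>) * \<Gamma>_bar v\<close>; hence slices of \<open>C_tilde\<close> are forward invariant, and
  each of their points is joined to \<open>xbar\<close> by a trajectory inside the slice. If the limit state is
  outside the closure of \<open>D v\<close>, these trajectories cross the frontier of \<open>D v\<close>, and a limit of crossing
  points (which stay in the compact set \<open>X\<close>) violates the frontier bound.

  The inclusion in \<open>X_tilde\<close> holds because the minimum of \<open>V\<close> over the open set \<open>- X_ref v \<inter> D v\<close> would
  be a critical point, and because \<open>\<Gamma>_star v < 0\<close> for inadmissible \<open>v\<close>.\<close>

section \<open>Calculus of continuously differentiable maps\<close>

lemma C1_on_imp_continuous_on: "C1_on S F \<Longrightarrow> continuous_on S F"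
  unfolding C1_on_def
  by (meson continuous_at_imp_continuous_on has_derivative_continuous)

lemma C1_on_subset: "C1_on S F \<Longrightarrow> T \<subseteq> S \<Longrightarrow> C1_on T F"
  unfolding C1_on_def by (meson continuous_on_subset subsetD)

lemma C1_on_add:
  assumes "C1_on S F" "C1_on S G"
  shows "C1_on S (\<lambda>x. F x + G x)"
proof -
  from assms obtain F' G' where
    F: "\<And>x. x \<in> S \<Longrightarrow> (F has_derivative blinfun_apply (F' x)) (at x)" "continuous_on S F'" and
    G: "\<And>x. x \<in> S \<Longrightarrow> (G has_derivative blinfun_apply (G' x)) (at x)" "continuous_on S G'"
    unfolding C1_on_def by blast
  have "((\<lambda>x. F x + G x) has_derivative blinfun_apply (F' x + G' x)) (at x)" if "x \<in> S" for x
    using has_derivative_add[OF F(1) G(1), OF that that] by (simp add: plus_blinfun.rep_eq)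
  moreover have "continuous_on S (\<lambda>x. F' x + G' x)"
    using F(2) G(2) by (intro continuous_intros)
  ultimately show ?thesis unfolding C1_on_def by (intro exI[of _ "\<lambda>x. F' x + G' x"]) blast
qed

text \<open>One rule for negation, multiplication by a constant and placing a scalar function along
  an axis vector.\<close>

lemma C1_on_bounded_linear:
  assumes "bounded_linear L" "C1_on S F"
  shows "C1_on S (\<lambda>x. L (F x))"
proof -
  from assms obtain F' where
    F: "\<And>x. x \<in> S \<Longrightarrow> (F has_derivative blinfun_apply (F' x)) (at x)" "continuous_on S F'"
    unfolding C1_on_def by blast
  have "((\<lambda>x. L (F x)) has_derivative blinfun_apply (Blinfun L o\<^sub>L F' x)) (at x)" if "x \<in> S" for x
    using bounded_linear.has_derivative[OF assms(1) F(1)[OF that]]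
    by (simp add: bounded_linear_Blinfun_apply[OF assms(1)] blinfun_compose.rep_eq comp_def)
  moreover have "continuous_on S (\<lambda>x. Blinfun L o\<^sub>L F' x)"
    using F(2) by (intro continuous_intros)
  ultimately show ?thesis
    unfolding C1_on_def by (intro exI[of _ "\<lambda>x. Blinfun L o\<^sub>L F' x"]) blast
qed

lemma C1_on_diff:
  assumes "C1_on S F" "C1_on S G"
  shows "C1_on S (\<lambda>x. F x - G x)"
  using C1_on_add[OF assms(1) C1_on_bounded_linear[OF bounded_linear_minus[OF bounded_linear_ident] assms(2)]]
  by simp

text \<open>Lifts the thresholds, which are functions of the reference alone, to state-reference
  pairs.\<close>

lemma C1_on_snd:
  assumes "C1_on UNIV F"
  shows "C1_on S (\<lambda>p. F (snd p))"
proof -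
  from assms obtain F' where
    F: "\<And>x. (F has_derivative blinfun_apply (F' x)) (at x)" "continuous_on UNIV F'"
    unfolding C1_on_def by blast
  have "((\<lambda>p. F (snd p)) has_derivative blinfun_apply (F' (snd p) o\<^sub>L snd_blinfun)) (at p)" for p
    using has_derivative_compose[OF has_derivative_snd[OF has_derivative_ident] F(1)]
    by (simp add: blinfun_compose.rep_eq snd_blinfun.rep_eq comp_def)
  moreover have "continuous_on S (\<lambda>p. F' (snd p) o\<^sub>L snd_blinfun)"
    by (intro continuous_intros continuous_on_compose2[OF F(2)]) auto
  ultimately show ?thesis
    unfolding C1_on_def by (intro exI[of _ "\<lambda>p. F' (snd p) o\<^sub>L snd_blinfun"]) blast
qed

lemma C1_on_vector_2:
  assumes "C1_on S F" "C1_on S G"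
  shows "C1_on S (\<lambda>x. vector [F x, G x] :: real^2)"
proof -
  have "(\<lambda>x. vector [F x, G x] :: real^2) = (\<lambda>x. F x *\<^sub>R axis 1 1 + G x *\<^sub>R axis 2 1)"
    by (auto simp: fun_eq_iff vec_eq_iff forall_2 axis_def)
  then show ?thesis
    using assms by (auto intro!: C1_on_add C1_on_bounded_linear[of "\<lambda>r. r *\<^sub>R _"] bounded_linear_scaleR_left)
qed

text \<open>\<open>frechet_derivative\<close> is a choice operator, so it is meaningful only once a
  derivative exists; the chain rule along \<open>\<lambda>y. (y, v)\<close> provides one.\<close>

lemma C1_on_partial_has_derivative:
  assumes "C1_on UNIV W"
  shows "((\<lambda>y. W (y, v)) has_derivative frechet_derivative (\<lambda>y. W (y, v)) (at x)) (at x)"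
proof -
  from assms obtain W' where "(W has_derivative W') (at (x, v))"
    unfolding C1_on_def by auto
  then have "((\<lambda>y. W (y, v)) has_derivative (\<lambda>h. W' (h, 0))) (at x)"
    by (intro has_derivative_compose[where g = W and f = "\<lambda>y. (y, v)"])
       (auto intro!: derivative_eq_intros)
  then show ?thesis
    using differentiable_def frechet_derivative_works by blast
qed

section \<open>Comparison functions\<close>

lemma class_K_pos:
  assumes "class_K \<gamma>" "0 < s"
  shows "0 < \<gamma> s"
  using assms strict_mono_onD[of "{0..}" \<gamma> 0 s] by (simp add: class_K_def)

lemma class_K_mono:
  assumes "class_K \<gamma>" "0 \<le> s" "s \<le> t"
  shows "\<gamma> s \<le> \<gamma> t"
  using assms strict_mono_on_leD[of "{0..}" \<gamma> s t] by (simp add: class_K_def)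

section \<open>Paths crossing a frontier\<close>

lemma path_crosses_frontier:
  fixes \<phi> :: "real \<Rightarrow> 'a::topological_space"
  assumes "continuous_on {a..b} \<phi>" "a \<le> b" "\<phi> a \<in> S" "\<phi> b \<notin> S"
  shows "\<exists>t\<in>{a..b}. \<phi> t \<in> frontier S"
proof -
  have "connected (\<phi> ` {a..b})"
    using assms(1) by (intro connected_continuous_image) auto
  moreover have "\<phi> ` {a..b} \<inter> S \<noteq> {}" "\<phi> ` {a..b} - S \<noteq> {}"
    using assms(2-4) by (force simp: image_iff)+
  ultimately show ?thesis
    using connected_Int_frontier by blast
qed

text \<open>The times spent outside an open set form a closed set, so their infimum is attained. The
  path meets the frontier no later than that, and frontier points of an open set lie outside it, so
  the meeting time is the infimum itself.\<close>

lemma first_exit: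
  fixes \<phi> :: "real \<Rightarrow> 'a::topological_space"
  assumes cont: "continuous_on {a..b} \<phi>" and "a \<le> b" and S: "open S" and "\<phi> a \<in> S" "\<phi> b \<notin> S"
  obtains t where "a \<le> t" "t \<le> b" "\<phi> t \<in> frontier S" "\<And>s. a \<le> s \<Longrightarrow> s < t \<Longrightarrow> \<phi> s \<in> S"
proof -
  define E where "E = {a..b} \<inter> \<phi> -` (- S)"
  have "closed E"
    unfolding E_def using cont S by (intro continuous_closed_preimage) auto
  moreover have bE: "b \<in> E" and bdd: "bdd_below E"
    using assms by (auto simp: E_def)
  ultimately have tE: "Inf E \<in> E"
    using closed_contains_Inf by blast
  then have t: "a \<le> Inf E" "Inf E \<le> b" "\<phi> (Inf E) \<notin> S"
    by (auto simp: E_def)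
  have before: "\<phi> s \<in> S" if "a \<le> s" "s < Inf E" for s
    using that cInf_lower[OF _ bdd, of s] t(2) by (force simp: E_def)
  have "continuous_on {a..Inf E} \<phi>"
    using cont t(2) by (auto intro: continuous_on_subset)
  then obtain r where r: "a \<le> r" "r \<le> Inf E" "\<phi> r \<in> frontier S"
    using path_crosses_frontier[of a "Inf E" \<phi> S] t assms(4) by auto
  then have "\<phi> r \<notin> S"
    using S by (simp add: frontier_def interior_open)
  then have "r = Inf E"
    using before r by fastforce
  then show thesis
    using that r t before by blast
qed

text \<open>Collects the hypotheses of the theorem. Equating the extended-real thresholds with
  \<open>ereal (\<Gamma>_star v)\<close> and \<open>ereal (\<Gamma>_bar v)\<close> expresses that
  they are real-valued.\<close>

locale Lyapunov_margin = prestabilized_system f g X U xbar ubar \<pi> D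
  for f :: "real^'n \<Rightarrow> real^'n"
    and g :: "real^'n \<Rightarrow> real^'m^'n"
    and X :: "(real^'n) set"
    and U :: "(real^'m) set"
    and xbar :: "real^'l \<Rightarrow> real^'n"
    and ubar :: "real^'l \<Rightarrow> real^'m"
    and \<pi> :: "(real^'n) \<times> (real^'l) \<Rightarrow> real^'m"
    and D :: "real^'l \<Rightarrow> (real^'n) set" +
  fixes V :: "(real^'n) \<times> (real^'l) \<Rightarrow> real"
    and \<Gamma>_star \<Gamma>_bar :: "real^'l \<Rightarrow> real"
    and \<epsilon> :: real
  assumes Lyapunov: "ref_Lyapunov V"
    and noncritical: "\<And>v x. x \<in> D v - {xbar v} \<Longrightarrow>
          frechet_derivative (\<lambda>y. V (y, v)) (at x) \<noteq> (\<lambda>_. 0)"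
    and safety: "\<And>v. safety_threshold V v = ereal (\<Gamma>_star v)"
    and \<Gamma>_star_C1: "C1_on UNIV \<Gamma>_star"
    and stability: "\<And>v. stability_threshold V v = ereal (\<Gamma>_bar v)"
    and \<Gamma>_bar_C1: "C1_on UNIV \<Gamma>_bar"
    and X_compact: "compact X"
    and admissible_compact: "compact admissible_refs"
    and \<epsilon>: "0 < \<epsilon>" "\<epsilon> < 1"
begin

definition margin :: "(real^'n) \<times> (real^'l) \<Rightarrow> real^2" where
  "margin = (\<lambda>(x, v). vector [\<Gamma>_star v - V (x, v), (1 - \<epsilon>) * \<Gamma>_bar v - V (x, v)])"

section \<open>Estimates for the Lyapunov function\<close>

lemma V_C1: "C1_on UNIV V"
  using Lyapunov by (simp add: ref_Lyapunov_def)

lemmas V_partial = C1_on_partial_has_derivative[OF V_C1]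

lemma V_slice_continuous: "continuous_on S (\<lambda>y. V (y, v))"
  by (intro continuous_on_compose2[OF C1_on_imp_continuous_on[OF V_C1]] continuous_intros) auto

lemma V_decrease: "x \<in> D v \<Longrightarrow> frechet_derivative (\<lambda>y. V (y, v)) (at x) (f_cl (x, v)) \<le> 0"
  using Lyapunov unfolding ref_Lyapunov_def by blast

lemma V_lower:
  obtains \<gamma> where "class_K \<gamma>" "\<And>v x. x \<in> D v \<Longrightarrow> \<gamma> (norm (x - xbar v)) \<le> V (x, v)"
  using Lyapunov unfolding ref_Lyapunov_def by blast

lemma V_nonneg:
  assumes "x \<in> D v"
  shows "0 \<le> V (x, v)"
proof -
  obtain \<gamma> where "class_K \<gamma>" "\<And>v x. x \<in> D v \<Longrightarrow> \<gamma> (norm (x - xbar v)) \<le> V (x, v)"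
    using V_lower by metis
  then show ?thesis
    using class_K_mono[of \<gamma> 0 "norm (x - xbar v)"] assms by (force simp: class_K_def)
qed

lemma V_xbar [simp]: "V (xbar v, v) = 0"
proof -
  obtain \<gamma> where "class_K \<gamma>" "V (xbar v, v) \<le> \<gamma> (norm (xbar v - xbar v))"
    using Lyapunov xbar_in_D unfolding ref_Lyapunov_def by blast
  then show ?thesis
    using V_nonneg[OF xbar_in_D] by (simp add: class_K_def antisym)
qed

text \<open>The lower comparison function \<open>\<gamma>\<close> is increasing and common to all
  references, so \<open>d = \<gamma> e\<close> works.\<close>

lemma V_small_imp_near:
  assumes "0 < e"
  obtains d where "0 < d" "\<And>x v. x \<in> D v \<Longrightarrow> V (x, v) < d \<Longrightarrow> dist x (xbar v) < e"
proof -
  obtain \<gamma> where K: "class_K \<gamma>"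
    and \<gamma>: "\<And>v x. x \<in> D v \<Longrightarrow> \<gamma> (norm (x - xbar v)) \<le> V (x, v)"
    using V_lower by metis
  show thesis
  proof (rule that[of "\<gamma> e"])
    show "0 < \<gamma> e" using K assms by (rule class_K_pos)
    fix x v assume x: "x \<in> D v" and V: "V (x, v) < \<gamma> e"
    show "dist x (xbar v) < e"
    proof (rule ccontr)
      assume "\<not> dist x (xbar v) < e"
      then have "\<gamma> e \<le> \<gamma> (norm (x - xbar v))"
        using class_K_mono[OF K] assms by (simp add: dist_norm)
      with \<gamma>[OF x] V show False by linarith
    qed
  qed
qed

text \<open>The lower bound by \<open>\<gamma>\<close> is given only on \<open>D v\<close>;
  continuity carries it to the closure, and the frontier avoids \<open>xbar v\<close> because
  \<open>D v\<close> is open.\<close>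

lemma V_pos_frontier:
  assumes "y \<in> frontier (D v)"
  shows "0 < V (y, v)"
proof -
  have "y \<noteq> xbar v"
    using assms xbar_in_D[of v] D_open[of v] by (auto simp: frontier_def interior_open)
  obtain \<gamma> where K: "class_K \<gamma>"
    and \<gamma>: "\<And>v x. x \<in> D v \<Longrightarrow> \<gamma> (norm (x - xbar v)) \<le> V (x, v)"
    using V_lower by metis
  have "continuous_on (closure (D v)) (\<lambda>x. \<gamma> (norm (x - xbar v)))"
  proof (rule continuous_on_compose2[of "{0..}" \<gamma>])
    show "continuous_on {0..} \<gamma>"
      using K by (simp add: class_K_def)
  qed (auto intro!: continuous_intros)
  then have "continuous_on (closure (D v)) (\<lambda>x. V (x, v) - \<gamma> (norm (x - xbar v)))"
    by (intro continuous_on_diff V_slice_continuous)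
  moreover have "y \<in> closure (D v)"
    using assms by (simp add: frontier_def)
  moreover have "0 \<le> V (x, v) - \<gamma> (norm (x - xbar v))" if "x \<in> D v" for x
    using \<gamma>[OF that] by simp
  ultimately have "0 \<le> V (y, v) - \<gamma> (norm (y - xbar v))"
    by (rule continuous_ge_on_closure)
  moreover have "0 < \<gamma> (norm (y - xbar v))"
    using \<open>y \<noteq> xbar v\<close> by (intro class_K_pos[OF K]) simp
  ultimately show ?thesis by linarith
qed

text \<open>The factor \<open>1 - \<epsilon>\<close> lowers the bound strictly only where
  \<open>\<Gamma>_bar v\<close> is positive; if the claim failed, positivity of \<open>V\<close> on
  the frontier would force exactly that.\<close>

lemma frontier_above_threshold:
  assumes "y \<in> frontier (D v)"
  shows "(1 - \<epsilon>) * \<Gamma>_bar v < V (y, v)"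
proof (rule ccontr)
  assume "\<not> ?thesis"
  then have le: "V (y, v) \<le> (1 - \<epsilon>) * \<Gamma>_bar v" by simp
  then have "0 < (1 - \<epsilon>) * \<Gamma>_bar v"
    using V_pos_frontier[OF assms] by linarith
  then have "0 < \<epsilon> * \<Gamma>_bar v"
    using \<epsilon> by (simp add: zero_less_mult_iff)
  moreover have "ereal (\<Gamma>_bar v) \<le> ereal (V (y, v))"
    unfolding stability[symmetric] stability_threshold_def using assms by (rule INF_lower)
  ultimately show False
    using le by (simp add: algebra_simps)
qed

section \<open>Safety of the sublevel sets\<close>

lemma closed_X_ref: "closed (X_ref v)"
proof -
  have "X_ref v = X \<inter> (\<lambda>x. \<pi> (x, v)) -` U"
    by (auto simp: X_ref_def)
  moreover have "continuous_on X (\<lambda>x. \<pi> (x, v))"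
    by (intro continuous_on_compose2[OF pi_continuous] continuous_intros) auto
  ultimately show ?thesis
    using X_closed U_closed by (simp add: continuous_closed_preimage)
qed

lemma xbar_in_X_ref_iff: "xbar v \<in> X_ref v \<longleftrightarrow> v \<in> admissible_refs"
  by (simp add: X_ref_def admissible_refs_def pi_equilibrium)

text \<open>The infimum is attained at \<open>xbar v\<close>. As \<open>xbar v\<close> lies in
  \<open>X_ref v\<close> or in its complement, one of the two infima in
  \<open>safety_threshold\<close> always vanishes.\<close>

lemma INF_V_eq_0:
  assumes "xbar v \<in> S"
  shows "(INF x \<in> S \<inter> D v. ereal (V (x, v))) = 0"
proof (rule antisym)
  show "(INF x \<in> S \<inter> D v. ereal (V (x, v))) \<le> 0"
    using INF_lower[of "xbar v" "S \<inter> D v" "\<lambda>x. ereal (V (x, v))"] assms xbar_in_D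
    by (simp add: zero_ereal_def)
  show "0 \<le> (INF x \<in> S \<inter> D v. ereal (V (x, v)))"
    using V_nonneg by (intro INF_greatest) auto
qed

text \<open>For inadmissible \<open>v\<close> the first infimum vanishes, so
  \<open>\<Gamma>_star v\<close> is minus the second one, \<open>I\<close>. A point as assumed gives
  \<open>I \<le> 0\<close>, so \<open>X_ref v\<close> has points with arbitrarily small
  \<open>V\<close>, hence arbitrarily close to \<open>xbar v\<close>; closedness then puts
  \<open>xbar v\<close> into \<open>X_ref v\<close>.\<close>

lemma safe_sublevel_admissible:
  assumes "x \<in> D v" "V (x, v) \<le> \<Gamma>_star v"
  shows "v \<in> admissible_refs"
proof (rule ccontr)
  assume "v \<notin> admissible_refs"
  then have xbar: "xbar v \<notin> X_ref v"
    using xbar_in_X_ref_iff by simp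
  define I where "I = (INF x \<in> X_ref v \<inter> D v. ereal (V (x, v)))"
  have "0 - I = ereal (\<Gamma>_star v)"
    using safety[of v] xbar by (simp add: safety_threshold_def INF_V_eq_0 I_def)
  \<comment> \<open>An infinite \<open>I\<close> is excluded because \<open>\<Gamma>_star v\<close>
    is real.\<close>
  then have "I = ereal (- \<Gamma>_star v)"
    by (cases I) (auto simp: zero_ereal_def)
  then have I: "I \<le> 0"
    using assms V_nonneg[of x v] by (simp add: zero_ereal_def)
  have "xbar v \<in> closure (X_ref v)"
    unfolding closure_approachable
  proof (intro allI impI)
    fix e :: real assume "0 < e"
    then obtain d where d: "0 < d" "\<And>x v. x \<in> D v \<Longrightarrow> V (x, v) < d \<Longrightarrow> dist x (xbar v) < e"
      using V_small_imp_near by blast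
    have "I < ereal d"
      using I d(1) by (simp add: le_less_trans)
    then show "\<exists>y\<in>X_ref v. dist y (xbar v) < e"
      using d(2) unfolding I_def INF_less_iff by auto
  qed
  with xbar show False
    using closed_X_ref by simp
qed

text \<open>For admissible \<open>v\<close> the second infimum vanishes, so
  \<open>\<Gamma>_star v\<close> is the infimum of \<open>V\<close> over the unsafe part of
  \<open>D v\<close>. An unsafe point at or below this level is an interior minimizer other than
  \<open>xbar v\<close>, against \<open>noncritical\<close>.\<close>

lemma safe_sublevel_in_X_ref:
  assumes x: "x \<in> D v" and V: "V (x, v) \<le> \<Gamma>_star v"
  shows "x \<in> X_ref v"
proof (rule ccontr)
  assume nx: "x \<notin> X_ref v"
  have xbar: "xbar v \<in> X_ref v"
    using safe_sublevel_admissible[OF assms] xbar_in_X_ref_iff by simp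
  then have "(INF x \<in> - X_ref v \<inter> D v. ereal (V (x, v))) = ereal (\<Gamma>_star v)"
    using safety[of v] by (simp add: safety_threshold_def INF_V_eq_0)
  then have "ereal (\<Gamma>_star v) \<le> ereal (V (y, v))" if "y \<in> - X_ref v \<inter> D v" for y
    using that by (metis (no_types, lifting) INF_lower)
  then have min: "\<forall>y\<in>- X_ref v \<inter> D v. V (x, v) \<le> V (y, v)"
    using V by fastforce
  have "open (- X_ref v \<inter> D v)"
    using closed_X_ref D_open by (simp add: open_Compl open_Int)
  then have "frechet_derivative (\<lambda>y. V (y, v)) (at x) = (\<lambda>_. 0)"
    using nx x min by (intro differential_zero_maxmin[OF _ _ V_partial]) auto
  moreover have "x \<noteq> xbar v"
    using nx xbar by blast
  ultimately show False
    using noncritical[of x v] x by blast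
qed

lemma mem_C_margin_iff:
  "(x, v) \<in> C_tilde margin \<longleftrightarrow>
     x \<in> D v \<and> V (x, v) \<le> \<Gamma>_star v \<and> V (x, v) \<le> (1 - \<epsilon>) * \<Gamma>_bar v"
  by (simp add: C_tilde_def D_tilde_def margin_def forall_2)

lemma C_margin_subset: "C_tilde margin \<subseteq> X_tilde"
  using safe_sublevel_in_X_ref safe_sublevel_admissible
  by (auto simp: mem_C_margin_iff X_tilde_def)

section \<open>Forward invariance along trajectories\<close>

text \<open>Membership in \<open>D v\<close> is asked only before time \<open>t\<close>, so that the
  bound still applies at an exit time, when the state is on the frontier.\<close>

lemma V_nonincreasing:
  assumes sol: "solution_from (\<lambda>x. f_cl (x, v)) x0 \<phi>" and "0 \<le> t"
    and D: "\<And>s. 0 \<le> s \<Longrightarrow> s < t \<Longrightarrow> \<phi> s \<in> D v"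
  shows "V (\<phi> t, v) \<le> V (x0, v)"
proof -
  have \<phi>: "(\<phi> has_vector_derivative f_cl (\<phi> s, v)) (at s within {0..})" if "0 \<le> s" for s
    using sol that unfolding solution_from_def by blast
  then have "continuous_on {0..} \<phi>"
    by (auto simp: continuous_on_eq_continuous_within intro: has_vector_derivative_continuous)
  then have cont: "continuous_on {0..t} (\<lambda>s. V (\<phi> s, v))"
    by (intro continuous_on_compose2[OF V_slice_continuous[of UNIV v]])
       (auto intro: continuous_on_subset)
  have "((\<lambda>s. V (\<phi> s, v)) has_real_derivative
      frechet_derivative (\<lambda>y. V (y, v)) (at (\<phi> s)) (f_cl (\<phi> s, v))) (at s)" if "0 < s" for s
  proof -
    \<comment> \<open>At positive times the derivative within \<open>{0..}\<close> is
      two-sided.\<close>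
    have "(\<phi> has_vector_derivative f_cl (\<phi> s, v)) (at s)"
      using \<phi>[of s] that at_within_interior[of s "{0..}"] by (simp add: interior_real_atLeast)
    from has_derivative_compose[OF this[unfolded has_vector_derivative_def] V_partial]
    show ?thesis
      by (simp add: has_field_derivative_def linear_scale[OF has_derivative_linear[OF V_partial]]
          mult_commute_abs)
  qed
  moreover have "frechet_derivative (\<lambda>y. V (y, v)) (at (\<phi> s)) (f_cl (\<phi> s, v)) \<le> 0"
    if "0 < s" "s < t" for s
    using V_decrease D that by simp
  ultimately have "V (\<phi> t, v) \<le> V (\<phi> 0, v)"
    using DERIV_nonpos_imp_decreasing_open[OF \<open>0 \<le> t\<close> _ cont] by blast
  then show ?thesis
    using sol by (simp add: solution_from_def)
qed

text \<open>At a first exit from \<open>D v\<close> the state would be on the frontier with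
  \<open>V\<close> no larger than initially, contradicting \<open>frontier_above_threshold\<close>.
  Inside \<open>D v\<close> both bounds persist, since the reference is frozen and \<open>V\<close>
  does not increase.\<close>

lemma C_margin_invariant:
  assumes x0: "(x0, v) \<in> C_tilde margin" and sol: "solution_from (\<lambda>x. f_cl (x, v)) x0 \<phi>"
    and "0 \<le> t"
  shows "(\<phi> t, v) \<in> C_tilde margin"
proof -
  have cont: "continuous_on {0..} \<phi>" and \<phi>0: "\<phi> 0 = x0"
    using sol unfolding solution_from_def
    by (auto simp: continuous_on_eq_continuous_within intro: has_vector_derivative_continuous)
  have D: "\<phi> s \<in> D v" if s: "0 \<le> s" for s
  proof (rule ccontr)
    assume "\<phi> s \<notin> D v"
    moreover have "continuous_on {0..s} \<phi>"
      using cont by (rule continuous_on_subset) auto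
    moreover have "\<phi> 0 \<in> D v"
      using x0 \<phi>0 by (simp add: mem_C_margin_iff)
    ultimately obtain r where r: "0 \<le> r" "\<phi> r \<in> frontier (D v)"
      and before: "\<And>s. 0 \<le> s \<Longrightarrow> s < r \<Longrightarrow> \<phi> s \<in> D v"
      using first_exit[of 0 s \<phi> "D v"] s D_open[of v] by metis
    have "V (\<phi> r, v) \<le> V (x0, v)"
      using V_nonincreasing[OF sol r(1) before] .
    then show False
      using frontier_above_threshold[OF r(2)] x0 by (simp add: mem_C_margin_iff)
  qed
  have "V (\<phi> t, v) \<le> V (x0, v)"
    using V_nonincreasing[OF sol \<open>0 \<le> t\<close>] D by blast
  then show ?thesis
    using D[OF \<open>0 \<le> t\<close>] x0 by (simp add: mem_C_margin_iff)
qed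

text \<open>Two references interact: the trajectory belongs to \<open>w\<close> and stays in the
  slice over \<open>w\<close>, while the set it has to enter on its way to \<open>xbar w\<close>
  belongs to \<open>v\<close>.\<close>

lemma C_margin_meets_frontier:
  assumes x0: "(x0, w) \<in> C_tilde margin" and "x0 \<notin> D v" "xbar w \<in> D v"
  obtains y where "(y, w) \<in> C_tilde margin" "y \<in> frontier (D v)"
proof -
  have "x0 \<in> D w"
    using x0 by (simp add: mem_C_margin_iff)
  then obtain \<phi> where sol: "solution_from (\<lambda>x. f_cl (x, w)) x0 \<phi>"
    and lim: "(\<phi> \<longlongrightarrow> xbar w) at_top"
    using D_attraction[of w] unfolding solutions_converge_def by blast
  have cont: "continuous_on {0..} \<phi>" and \<phi>0: "\<phi> 0 = x0"
    using sol unfolding solution_from_def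
    by (auto simp: continuous_on_eq_continuous_within intro: has_vector_derivative_continuous)
  have "\<forall>\<^sub>F t in at_top. \<phi> t \<in> D v \<and> 0 \<le> t"
    using topological_tendstoD[OF lim D_open \<open>xbar w \<in> D v\<close>] eventually_ge_at_top[of 0]
    by (rule eventually_conj)
  then obtain b where b: "\<phi> b \<in> D v" "0 \<le> b"
    using eventually_happens by force
  have "continuous_on {0..b} \<phi>"
    using cont by (rule continuous_on_subset) auto
  \<comment> \<open>The path enters \<open>D v\<close>, that is, leaves the complement, which has
    the same frontier.\<close>
  then obtain t where "t \<in> {0..b}" "\<phi> t \<in> frontier (- D v)"
    using path_crosses_frontier[of 0 b \<phi> "- D v"] b \<phi>0 \<open>x0 \<notin> D v\<close> by auto
  then show thesis
    using that[of "\<phi> t"] C_margin_invariant[OF x0 sol] by (simp add: frontier_complement)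
qed

section \<open>Compactness of the safe set\<close>

lemma threshold_limits:
  assumes "\<And>k. (x k, w k) \<in> C_tilde margin" "x \<longlonglongrightarrow> a" "w \<longlonglongrightarrow> v"
  shows "V (a, v) \<le> \<Gamma>_star v" "V (a, v) \<le> (1 - \<epsilon>) * \<Gamma>_bar v"
proof -
  have V: "(\<lambda>k. V (x k, w k)) \<longlonglongrightarrow> V (a, v)"
    using continuous_on_tendsto_compose[OF C1_on_imp_continuous_on[OF V_C1] tendsto_Pair[OF assms(2,3)]]
    by simp
  have "(\<lambda>k. \<Gamma>_star (w k)) \<longlonglongrightarrow> \<Gamma>_star v"
    using continuous_on_tendsto_compose[OF C1_on_imp_continuous_on[OF \<Gamma>_star_C1] assms(3)] by simp
  with V show "V (a, v) \<le> \<Gamma>_star v"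
    using assms(1) by (intro LIMSEQ_le) (auto simp: mem_C_margin_iff)
  have "(\<lambda>k. (1 - \<epsilon>) * \<Gamma>_bar (w k)) \<longlonglongrightarrow> (1 - \<epsilon>) * \<Gamma>_bar v"
    using continuous_on_tendsto_compose[OF C1_on_imp_continuous_on[OF \<Gamma>_bar_C1] assms(3)]
    by (intro tendsto_intros) simp
  with V show "V (a, v) \<le> (1 - \<epsilon>) * \<Gamma>_bar v"
    using assms(1) by (intro LIMSEQ_le) (auto simp: mem_C_margin_iff)
qed

text \<open>The bound surviving in the limit is incompatible with the strict bound on the
  frontier.\<close>

lemma limit_notin_frontier:
  assumes "\<And>k. (y k, w k) \<in> C_tilde margin" "y \<longlonglongrightarrow> a" "w \<longlonglongrightarrow> v"
  shows "a \<notin> frontier (D v)"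
  using threshold_limits(2)[OF assms] frontier_above_threshold[of a v] by auto

text \<open>A limit outside \<open>D v\<close> lies outside its closure, so eventually
  \<open>x k\<close> is outside \<open>D v\<close> while \<open>xbar (w k)\<close> is inside. The
  crossing points all lie on the one closed set \<open>frontier (D v)\<close>, and so does any limit
  of them, contradicting \<open>limit_notin_frontier\<close>.\<close>

lemma limit_in_D:
  assumes C: "\<And>k. (x k, w k) \<in> C_tilde margin" and x: "x \<longlonglongrightarrow> a" and w: "w \<longlonglongrightarrow> v"
  shows "a \<in> D v"
proof (rule ccontr)
  assume "a \<notin> D v"
  then have "a \<in> - closure (D v)"
    using limit_notin_frontier[OF assms] D_open[of v] by (auto simp: frontier_def interior_open)
  then have "\<forall>\<^sub>F k in sequentially. x k \<in> - closure (D v)"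
    by (intro topological_tendstoD[OF x]) auto
  moreover have "(\<lambda>k. xbar (w k)) \<longlonglongrightarrow> xbar v"
    using continuous_on_tendsto_compose[OF xbar_continuous w] by simp
  then have "\<forall>\<^sub>F k in sequentially. xbar (w k) \<in> D v"
    using D_open xbar_in_D by (rule topological_tendstoD)
  ultimately have "\<forall>\<^sub>F k in sequentially. x k \<notin> D v \<and> xbar (w k) \<in> D v"
    by eventually_elim (use closure_subset in blast)
  then obtain N where N: "\<And>k. N \<le> k \<Longrightarrow> x k \<notin> D v \<and> xbar (w k) \<in> D v"
    unfolding eventually_sequentially by blast
  \<comment> \<open>Shifting by \<open>N\<close> yields a crossing point for every index, hence a
    full sequence.\<close>
  have "\<exists>y. (y, w (k + N)) \<in> C_tilde margin \<and> y \<in> frontier (D v)" for k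
    using C_margin_meets_frontier[OF C] N[of "k + N"] by (metis le_add2)
  then obtain y where y: "\<And>k. (y k, w (k + N)) \<in> C_tilde margin" "\<And>k. y k \<in> frontier (D v)"
    by metis
  \<comment> \<open>Safety supplies the compactness: invariance keeps the crossing points in the
    safe set, whose states lie in \<open>X\<close>.\<close>
  have "y k \<in> X" for k
    using y(1)[of k] C_margin_subset by (auto simp: X_tilde_def X_ref_def)
  then obtain b r where r: "strict_mono r" and lim: "(y \<circ> r) \<longlonglongrightarrow> b"
    using X_compact unfolding compact_def by blast
  have "b \<in> frontier (D v)"
    using closed_sequentially[OF frontier_closed _ lim] y(2) by simp
  moreover have "(\<lambda>k. w (r k + N)) \<longlonglongrightarrow> v"
    using LIMSEQ_subseq_LIMSEQ[OF LIMSEQ_ignore_initial_segment[OF w, of N] r] by (simp add: comp_def)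
  ultimately show False
    using limit_notin_frontier[of "y \<circ> r" "\<lambda>k. w (r k + N)" b v] y(1) lim by simp
qed

text \<open>Closed by sequences, and contained in the compact product of \<open>X\<close> and
  \<open>admissible_refs\<close> by the safety inclusion.\<close>

lemma compact_C_margin: "compact (C_tilde margin)"
proof -
  have "closed (C_tilde margin)"
    unfolding closed_sequential_limits
  proof (intro allI impI, elim conjE)
    fix p q assume p: "\<forall>k. p k \<in> C_tilde margin" and lim: "p \<longlonglongrightarrow> q"
    have "(fst (p k), snd (p k)) \<in> C_tilde margin" for k
      using p by simp
    note * = this tendsto_fst[OF lim] tendsto_snd[OF lim]
    have "(fst q, snd q) \<in> C_tilde margin"
      unfolding mem_C_margin_iff using limit_in_D[OF *] threshold_limits[OF *] by blast
    then show "q \<in> C_tilde margin" by simp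
  qed
  moreover have "C_tilde margin \<subseteq> X \<times> admissible_refs"
    using C_margin_subset by (auto simp: X_tilde_def X_ref_def)
  ultimately show ?thesis
    using compact_Int_closed[OF compact_Times[OF X_compact admissible_compact]]
    by (metis inf.absorb_iff2)
qed

section \<open>Smoothness and flow condition of the margin\<close>

lemma margin_C1: "C1_on S margin"
proof -
  have "margin = (\<lambda>p. vector [\<Gamma>_star (snd p) - V p, (1 - \<epsilon>) * \<Gamma>_bar (snd p) - V p])"
    by (auto simp: margin_def)
  moreover have "C1_on S V"
    using C1_on_subset[OF V_C1] by simp
  ultimately show ?thesis
    using C1_on_snd[OF \<Gamma>_star_C1] C1_on_snd[OF \<Gamma>_bar_C1]
    by (auto intro!: C1_on_vector_2 C1_on_diff C1_on_bounded_linear[OF bounded_linear_mult_right])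
qed

text \<open>With the reference frozen each threshold is a constant \<open>c\<close>, so the
  derivative is that of \<open>c - V\<close>, and \<open>V\<close> does not increase along
  \<open>f_cl\<close>.\<close>

lemma margin_partial_nonneg:
  assumes "x \<in> D v"
  shows "0 \<le> frechet_derivative (\<lambda>y. margin (y, v) $ i) (at x) (f_cl (x, v))"
proof -
  obtain c where "(\<lambda>y. margin (y, v) $ i) = (\<lambda>y. c - V (y, v))"
    using exhaust_2[of i] by (auto simp: margin_def)
  moreover have "((\<lambda>y. c - V (y, v)) has_derivative
      (\<lambda>h. - frechet_derivative (\<lambda>y. V (y, v)) (at x) h)) (at x)"
    by (auto intro!: derivative_eq_intros V_partial)
  ultimately have "frechet_derivative (\<lambda>y. margin (y, v) $ i) (at x) =
      (\<lambda>h. - frechet_derivative (\<lambda>y. V (y, v)) (at x) h)"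
    by (metis frechet_derivative_at)
  then show ?thesis
    using V_decrease[OF assms] by simp
qed

lemma margin_is_DSM: "dynamic_safety_margin margin"
  unfolding dynamic_safety_margin_def
  using margin_C1 C_margin_subset compact_C_margin margin_partial_nonneg
  by (simp add: D_tilde_def)

end

theorem theorem7:
  fixes f :: "real^'n \<Rightarrow> real^'n"
    and g :: "real^'n \<Rightarrow> real^'m^'n"
    and X :: "(real^'n) set"
    and U :: "(real^'m) set"
    and xbar :: "real^'l \<Rightarrow> real^'n"
    and ubar :: "real^'l \<Rightarrow> real^'m"
    and \<pi> :: "(real^'n) \<times> (real^'l) \<Rightarrow> real^'m"
    and D :: "real^'l \<Rightarrow> (real^'n) set"
    and V :: "(real^'n) \<times> (real^'l) \<Rightarrow> real"
    and \<Gamma>_star \<Gamma>_bar :: "real^'l \<Rightarrow> real"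
    and \<epsilon> :: real
  assumes "prestabilized_system f g X U xbar ubar \<pi> D"
    and "prestabilized_data.ref_Lyapunov f g xbar \<pi> D V"
    and "\<And>v x. x \<in> D v - {xbar v} \<Longrightarrow>
           frechet_derivative (\<lambda>y. V (y, v)) (at x) \<noteq> (\<lambda>_. 0)"
    and "\<And>v. prestabilized_data.safety_threshold X U \<pi> D V v = ereal (\<Gamma>_star v)"
    and "C1_on UNIV \<Gamma>_star"
    and "\<And>v. prestabilized_data.stability_threshold D V v = ereal (\<Gamma>_bar v)"
    and "C1_on UNIV \<Gamma>_bar"
    and "compact X"
    and "compact (prestabilized_data.admissible_refs X U xbar ubar)"
    and "\<epsilon> \<in> {0<..<1}"
  shows "prestabilized_data.dynamic_safety_margin f g X U xbar ubar \<pi> D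
           (\<lambda>(x, v). vector [\<Gamma>_star v - V (x, v), (1 - \<epsilon>) * \<Gamma>_bar v - V (x, v)] :: real^2)"
proof -
  interpret prestabilized_system f g X U xbar ubar \<pi> D
    by fact
  interpret Lyapunov_margin f g X U xbar ubar \<pi> D V \<Gamma>_star \<Gamma>_bar \<epsilon>
    using assms by unfold_locales auto
  show ?thesis
    using margin_is_DSM unfolding margin_def .
qed

end
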